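(* Let $n\ge 2$ and let $(q,m)$ be a planar balanced collisionless central configuration, with the primaries in the associated rigid motion. Put $s_i=|q_i|$, and consider the equation of motion of the massless particle on the $z$-axis $$\ddot z=-\sum_{i=1}^n\frac{m_iz}{(s_i^2+z^2)^{3/2}},$$ with conserved energy $E=E(z,\dot z)=\frac{\dot z^2}{2}-\sum_{i=1}^n\frac{m_i}{(s_i^2+z^2)^{1/2}}$. Then every solution of this equation is of one of the following types: 1. hyperbolic, when $E>0$; 2. parabolic, when $E=0$; 3. periodic, when $E_{min}:=-\sum_{i=1}^n\frac{m_i}{s_i}<E<0$; 4. an equilibrium solution, when $E=E_{min}$.
   Context: Masses are positive, positions $q_i$ are pairwise distinct points of the plane $\Pi=\{z=0\}\subset\mathbb{R}^3$, center of mass at the origin, gravitational constant $1$. Central configuration: there is $\lambda\in\mathbb{R}$ with $\nabla_jU(q)+\lambda m_jq_j=0$ for all $j$, where $U(q)=\sum_{i<j}\frac{m_im_j}{|q_i-q_j|}$. Balanced: for every $r>0$ such that $F_r:=\{i:|q_i|=r\}\ne\emptyset$, $\sum_{i\in F_r}m_iq_i=0$. Collisionless: $q_i\ne0$ for all $i$. Rigid motion: $x_j(t)=Q(\sqrt\lambda\, t)q_j$, with $Q(\theta)$ the rotation by angle $\theta$ about the $z$-axis. A solution $z(t)$ with $|z(t)|\to\infty$ as $t\to\infty$ is called hyperbolic (for $t\to\infty$) if $\lim_{t\to\infty}\dot z(t)=z_\infty$ exists and $z_\infty\neq0$, and parabolic if $\lim_{t\to\infty}\dot z(t)=0$. *)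

theory Defs
  imports "HOL-Analysis.Analysis"
begin

type_synonym positions = "nat \<Rightarrow> real ^ 3"
type_synonym masses = "nat \<Rightarrow> real"

text \<open>Bodies are indexed by \<open>{1..n}\<close>; values of \<open>m\<close> and \<open>q\<close> elsewhere are irrelevant.\<close>

definition planar_configuration :: "nat \<Rightarrow> masses \<Rightarrow> positions \<Rightarrow> bool" where
  "planar_configuration n m q \<longleftrightarrow>
     (\<forall>i\<in>{1..n}. m i > 0) \<and>
     (\<forall>i\<in>{1..n}. q i $ 3 = 0) \<and>
     inj_on q {1..n} \<and>
     (\<Sum>i=1..n. m i *\<^sub>R q i) = 0"

definition newton_potential :: "nat \<Rightarrow> masses \<Rightarrow> positions \<Rightarrow> real" where
  "newton_potential n m q =
     (\<Sum>j\<in>{1..n}. \<Sum>i\<in>{1..<j}. m i * m j / norm (q i - q j))"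

definition central_configuration :: "nat \<Rightarrow> masses \<Rightarrow> positions \<Rightarrow> bool" where
  "central_configuration n m q \<longleftrightarrow>
     (\<exists>lam::real. \<forall>j\<in>{1..n}. \<exists>g.
        GDERIV (\<lambda>x. newton_potential n m (q(j := x))) (q j) :> g \<and>
        g + (lam * m j) *\<^sub>R q j = 0)"

definition balanced :: "nat \<Rightarrow> masses \<Rightarrow> positions \<Rightarrow> bool" where
  "balanced n m q \<longleftrightarrow>
     (\<forall>r>0. {i\<in>{1..n}. norm (q i) = r} \<noteq> {} \<longrightarrow>
        (\<Sum>i\<in>{i\<in>{1..n}. norm (q i) = r}. m i *\<^sub>R q i) = 0)"

definition collisionless :: "nat \<Rightarrow> positions \<Rightarrow> bool" where
  "collisionless n q \<longleftrightarrow> (\<forall>i\<in>{1..n}. q i \<noteq> 0)"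

definition rot_z :: "real \<Rightarrow> real ^ 3 \<Rightarrow> real ^ 3" where
  "rot_z \<theta> v =
     vector [cos \<theta> * v $ 1 - sin \<theta> * v $ 2, sin \<theta> * v $ 1 + cos \<theta> * v $ 2, v $ 3]"

definition rigid_motion :: "real \<Rightarrow> positions \<Rightarrow> nat \<Rightarrow> real \<Rightarrow> real ^ 3" where
  "rigid_motion lam q j t = rot_z (sqrt lam * t) (q j)"

definition axial_accel :: "nat \<Rightarrow> masses \<Rightarrow> positions \<Rightarrow> real \<Rightarrow> real" where
  "axial_accel n m q z =
     - (\<Sum>i=1..n. m i * z / ((norm (q i))\<^sup>2 + z\<^sup>2) powr (3/2))"

definition axial_energy :: "nat \<Rightarrow> masses \<Rightarrow> positions \<Rightarrow> real \<Rightarrow> real \<Rightarrow> real" where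
  "axial_energy n m q z v =
     v\<^sup>2 / 2 - (\<Sum>i=1..n. m i / ((norm (q i))\<^sup>2 + z\<^sup>2) powr (1/2))"

definition energy_min :: "nat \<Rightarrow> masses \<Rightarrow> positions \<Rightarrow> real" where
  "energy_min n m q = - (\<Sum>i=1..n. m i / norm (q i))"

text \<open>
  The right-hand side \<open>axial_accel\<close> is the Newtonian attraction of the rigidly rotating
  primaries on a massless particle at \<open>(0,0,z)\<close>. The attraction points along the axis
  because the configuration is balanced.
\<close>

lemma norm_vec3_sq: "(norm (v :: real ^ 3))\<^sup>2 = (v $ 1)\<^sup>2 + (v $ 2)\<^sup>2 + (v $ 3)\<^sup>2"
  unfolding power2_norm_eq_inner by (simp add: inner_vec_def sum_3 power2_eq_square)

lemma axial_attraction: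
  fixes q :: positions and z :: real
  assumes planar: "planar_configuration n m q" and bal: "balanced n m q"
    and coll: "collisionless n q"
  defines "p \<equiv> (vector [0, 0, z] :: real ^ 3)"
  shows "(\<Sum>i=1..n. (m i / norm (rigid_motion lam q i t - p) ^ 3) *\<^sub>R (rigid_motion lam q i t - p))
         = vector [0, 0, axial_accel n m q z]"
proof -
  define \<theta> where "\<theta> = sqrt lam * t"
  have q3: "q i $ 3 = 0" if "i \<in> {1..n}" for i
    using planar that by (auto simp: planar_configuration_def)
  have nz: "q i \<noteq> 0" if "i \<in> {1..n}" for i
    using coll that by (auto simp: collisionless_def)
  define d where "d r = (r\<^sup>2 + z\<^sup>2) powr (3/2)" for r :: real
  have dist: "norm (rigid_motion lam q i t - p) ^ 3 = d (norm (q i))" if i: "i \<in> {1..n}" for i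
  proof -
    let ?x = "norm (rigid_motion lam q i t - p)"
    have "?x\<^sup>2 = (cos \<theta> * q i $ 1 - sin \<theta> * q i $ 2)\<^sup>2 + (sin \<theta> * q i $ 1 + cos \<theta> * q i $ 2)\<^sup>2 + z\<^sup>2"
      using q3[OF i] by (simp add: norm_vec3_sq rigid_motion_def rot_z_def p_def \<theta>_def)
    also have "\<dots> = ((sin \<theta>)\<^sup>2 + (cos \<theta>)\<^sup>2) * ((q i $ 1)\<^sup>2 + (q i $ 2)\<^sup>2) + z\<^sup>2"
      unfolding power2_eq_square by (simp only: algebra_simps)
    also have "\<dots> = (norm (q i))\<^sup>2 + z\<^sup>2"
      using q3[OF i] by (simp add: norm_vec3_sq)
    finally have e: "?x\<^sup>2 = (norm (q i))\<^sup>2 + z\<^sup>2" .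
    have "d (norm (q i)) = (?x powr 2) powr (3/2)"
      unfolding d_def e[symmetric] powr_numeral[OF norm_ge_zero] ..
    also have "\<dots> = ?x powr 3" unfolding powr_powr by (simp del: powr_numeral)
    also have "\<dots> = ?x ^ 3" by (rule powr_numeral[OF norm_ge_zero])
    finally show ?thesis by simp
  qed
  have bal_sum: "(\<Sum>i=1..n. (m i / d (norm (q i))) *\<^sub>R q i) = 0"
  proof -
    have "(\<Sum>i=1..n. (m i / d (norm (q i))) *\<^sub>R q i)
        = (\<Sum>r\<in>(\<lambda>i. norm (q i)) ` {1..n}. \<Sum>i\<in>{i\<in>{1..n}. norm (q i) = r}. (m i / d (norm (q i))) *\<^sub>R q i)"
      by (rule sum.image_gen) simp
    also have "\<dots> = (\<Sum>r\<in>(\<lambda>i. norm (q i)) ` {1..n}. 0)"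
    proof (rule sum.cong[OF refl])
      fix r assume r: "r \<in> (\<lambda>i. norm (q i)) ` {1..n}"
      then have "r > 0" using nz by auto
      moreover have "{i\<in>{1..n}. norm (q i) = r} \<noteq> {}" using r by auto
      ultimately have 0: "(\<Sum>i\<in>{i\<in>{1..n}. norm (q i) = r}. m i *\<^sub>R q i) = 0"
        using bal unfolding balanced_def by blast
      have "(\<Sum>i\<in>{i\<in>{1..n}. norm (q i) = r}. (m i / d (norm (q i))) *\<^sub>R q i)
          = (1 / d r) *\<^sub>R (\<Sum>i\<in>{i\<in>{1..n}. norm (q i) = r}. m i *\<^sub>R q i)"
        unfolding scaleR_sum_right by (rule sum.cong) auto
      then show "(\<Sum>i\<in>{i\<in>{1..n}. norm (q i) = r}. (m i / d (norm (q i))) *\<^sub>R q i) = 0"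
        using 0 by simp
    qed
    finally show ?thesis by simp
  qed
  define c where "c i = m i / d (norm (q i))" for i
  have comp: "(\<Sum>i=1..n. c i * q i $ k) = 0" for k
    using arg_cong[OF bal_sum, of "\<lambda>v. v $ k"] by (simp add: c_def)
  have "(\<Sum>i=1..n. (m i / norm (rigid_motion lam q i t - p) ^ 3) *\<^sub>R (rigid_motion lam q i t - p))
      = (\<Sum>i=1..n. c i *\<^sub>R (rigid_motion lam q i t - p))"
    using dist by (intro sum.cong) (auto simp: c_def)
  also have "\<dots> = vector [0, 0, axial_accel n m q z]"
  proof -
    have 1: "(\<Sum>i=1..n. c i * (cos \<theta> * q i $ 1 - sin \<theta> * q i $ 2))
        = cos \<theta> * (\<Sum>i=1..n. c i * q i $ 1) - sin \<theta> * (\<Sum>i=1..n. c i * q i $ 2)"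
      by (simp add: sum_distrib_left sum_subtractf algebra_simps)
    have 2: "(\<Sum>i=1..n. c i * (sin \<theta> * q i $ 1 + cos \<theta> * q i $ 2))
        = sin \<theta> * (\<Sum>i=1..n. c i * q i $ 1) + cos \<theta> * (\<Sum>i=1..n. c i * q i $ 2)"
      by (simp add: sum_distrib_left sum.distrib algebra_simps)
    have 3: "(\<Sum>i=1..n. c i * (q i $ 3 - z)) = axial_accel n m q z"
      unfolding axial_accel_def sum_negf[symmetric]
      by (rule sum.cong) (auto simp: c_def d_def q3)
    show ?thesis
      using 1 2 3
      by (simp add: vec_eq_iff forall_3 rigid_motion_def rot_z_def p_def \<theta>_def[symmetric] comp
          del: One_nat_def)
  qed
  finally show ?thesis .
qed

definition solves_on :: "nat \<Rightarrow> masses \<Rightarrow> positions \<Rightarrow> real set \<Rightarrow> (real \<Rightarrow> real) \<Rightarrow> bool" where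
  "solves_on n m q I z \<longleftrightarrow>
     open I \<and> is_interval I \<and> I \<noteq> {} \<and>
     (\<forall>t\<in>I. (z has_real_derivative deriv z t) (at t) \<and>
            (deriv z has_real_derivative axial_accel n m q (z t)) (at t))"

definition maximal_solution :: "nat \<Rightarrow> masses \<Rightarrow> positions \<Rightarrow> real set \<Rightarrow> (real \<Rightarrow> real) \<Rightarrow> bool" where
  "maximal_solution n m q I z \<longleftrightarrow>
     solves_on n m q I z \<and>
     (\<forall>J w. solves_on n m q J w \<and> I \<subseteq> J \<and> (\<forall>t\<in>I. w t = z t) \<longrightarrow> J = I)"

definition hyperbolic :: "(real \<Rightarrow> real) \<Rightarrow> bool" where
  "hyperbolic z \<longleftrightarrow>
     filterlim (\<lambda>t. \<bar>z t\<bar>) at_top at_top \<and>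
     (\<exists>z_inf. (deriv z \<longlongrightarrow> z_inf) at_top \<and> z_inf \<noteq> 0)"

definition parabolic :: "(real \<Rightarrow> real) \<Rightarrow> bool" where
  "parabolic z \<longleftrightarrow>
     filterlim (\<lambda>t. \<bar>z t\<bar>) at_top at_top \<and> (deriv z \<longlongrightarrow> 0) at_top"

definition periodic :: "(real \<Rightarrow> real) \<Rightarrow> bool" where
  "periodic z \<longleftrightarrow> (\<exists>T>0. \<forall>t. z (t + T) = z t)"

definition equilibrium :: "(real \<Rightarrow> real) \<Rightarrow> bool" where
  "equilibrium z \<longleftrightarrow> (\<exists>c. \<forall>t. z t = c)"

end

theory Submission
  imports Defs
begin

text \<open>
  The force \<open>f\<close> on the axis is globally Lipschitz, odd and attracting. Picard iteration therefore
  gives a solution on an interval whose length does not depend on the initial data, and gluing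
  such a solution onto a maximal one shows that the latter is global. The energy is
  \<open>v\<^sup>2 / 2 - W z\<close>, where \<open>W' = f\<close> and \<open>W > 0\<close> is even, maximal only at \<open>0\<close>, and tends to \<open>0\<close> at
  infinity. If \<open>E \<ge> 0\<close> the velocity never vanishes, the particle escapes and \<open>v\<^sup>2\<close> tends to
  \<open>2 * E\<close>. The same argument shows that for \<open>- W 0 < E < 0\<close> the velocity vanishes at arbitrarily
  late times; by uniqueness the orbit is symmetric in time about each of these.
\<close>

section \<open>Ordinary differential equations with a Lipschitz right-hand side\<close>

lemma norm_diff_le_vector_derivative:
  fixes g :: "real \<Rightarrow> 'a::real_normed_vector"
  assumes "convex S"
    and der: "\<And>t. t \<in> S \<Longrightarrow> (g has_vector_derivative g' t) (at t within S)"
    and bound: "\<And>t. t \<in> S \<Longrightarrow> norm (g' t) \<le> B"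
    and "s \<in> S" "t \<in> S"
  shows "norm (g s - g t) \<le> B * \<bar>s - t\<bar>"
proof -
  have "norm (g s - g t) \<le> B * norm (s - t)"
  proof (rule differentiable_bound[OF \<open>convex S\<close>])
    show "(g has_derivative (\<lambda>h. h *\<^sub>R g' x)) (at x within S)" if "x \<in> S" for x
      using der[OF that] by (simp add: has_vector_derivative_def)
    show "onorm (\<lambda>h. h *\<^sub>R g' x) \<le> B" if "x \<in> S" for x
      by (rule onorm_le) (use mult_right_mono[OF bound[OF that] abs_ge_zero] in \<open>simp add: mult.commute\<close>)
  qed (use assms in auto)
  then show ?thesis by simp
qed

text \<open>Picard-Lindelof: the integral operator contracts the sup distance by the factor
  \<open>L * \<delta>\<close>, so Banach's theorem yields a fixed point. The admissible
  \<open>\<delta>\<close> depends on \<open>L\<close> alone and not on \<open>t0\<close> or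
  \<open>x0\<close>; this uniformity is what later makes maximal solutions global.\<close>

lemma lipschitz_ode_local_existence:
  fixes F :: "'a::banach \<Rightarrow> 'a"
  assumes lip: "L-lipschitz_on UNIV F" and "\<delta> > 0" and small: "L * \<delta> < 1"
  obtains X where "X t0 = x0"
    and "\<And>t. t \<in> {t0 - \<delta><..<t0 + \<delta>} \<Longrightarrow> (X has_vector_derivative F (X t)) (at t)"
proof -
  define a b where "a = t0 - \<delta>" and "b = t0 + \<delta>"
  \<comment> \<open>Clamping time to \<open>{a..b}\<close> lets the Picard operator act on bounded
    continuous functions on the whole line, a complete metric space available as a type.\<close>
  define c where "c t = max a (min b t)" for t :: real
  have c_in: "c t \<in> {a..b}" for t
    using \<open>\<delta> > 0\<close> by (auto simp: c_def a_def b_def)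
  have t0_in: "t0 \<in> {a..b}"
    using \<open>\<delta> > 0\<close> by (auto simp: a_def b_def)
  have c_id: "c t = t" if "t \<in> {a..b}" for t
    using that by (auto simp: c_def)
  have "L \<ge> 0" using lip by (rule lipschitz_on_nonneg)
  define J where "J u s = integral {a..s} (\<lambda>r. F (u r))" for u :: "real \<Rightarrow> 'a" and s
  \<comment> \<open>The difference of two integrals based at \<open>a\<close> is the signed integral
    from \<open>t0\<close> to \<open>c t\<close>, so times before \<open>t0\<close> need no separate
    treatment.\<close>
  define P where "P u t = x0 + (J u (c t) - J u t0)" for u :: "real \<Rightarrow> 'a" and t
  have F_cont: "continuous_on {a..b} (\<lambda>r. F (u r))" if "continuous_on UNIV u" for u :: "real \<Rightarrow> 'a"
    by (rule continuous_on_compose2[OF lipschitz_on_continuous_on[OF lip]])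
      (use continuous_on_subset[OF that] in auto)
  have J_der: "(J u has_vector_derivative F (u s)) (at s within {a..b})"
    if "continuous_on UNIV u" "s \<in> {a..b}" for u s
    unfolding J_def by (rule integral_has_vector_derivative[OF F_cont[OF that(1)] that(2)])
  have P_bcontfun: "P u \<in> bcontfun" if u: "continuous_on UNIV u" for u
  proof -
    have J_cont: "continuous_on {a..b} (J u)"
      using J_der[OF u] by (meson continuous_on_vector_derivative)
    have c_cont: "continuous_on UNIV c"
      unfolding c_def by (intro continuous_intros)
    have "continuous_on UNIV (\<lambda>t. J u (c t))"
      by (rule continuous_on_compose2[OF J_cont c_cont]) (use c_in in auto)
    then have "continuous_on UNIV (P u)"
      unfolding P_def by (intro continuous_intros)
    moreover have "bounded (range (P u))"
    proof (rule bounded_subset)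
      have "continuous_on {a..b} (\<lambda>s. x0 + (J u s - J u t0))"
        by (intro continuous_intros J_cont)
      then show "bounded ((\<lambda>s. x0 + (J u s - J u t0)) ` {a..b})"
        by (intro compact_imp_bounded compact_continuous_image compact_Icc)
      show "range (P u) \<subseteq> (\<lambda>s. x0 + (J u s - J u t0)) ` {a..b}"
        unfolding P_def using c_in by blast
    qed
    ultimately show ?thesis by (simp add: bcontfun_def)
  qed
  define T where "T u = Bcontfun (P (apply_bcontfun u))" for u :: "real \<Rightarrow>\<^sub>C 'a"
  have T: "apply_bcontfun (T u) = P (apply_bcontfun u)" for u
    unfolding T_def by (rule Bcontfun_inverse[OF P_bcontfun]) simp
  have "dist (T u) (T w) \<le> L * \<delta> * dist u w" for u w
  proof (rule dist_bound)
    fix t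
    let ?D = "\<lambda>s. J (apply_bcontfun u) s - J (apply_bcontfun w) s"
    \<comment> \<open>The mean value inequality replaces an estimate of integrals: the integrands
      differ by at most \<open>L * dist u w\<close>.\<close>
    have "norm (?D (c t) - ?D t0) \<le> L * dist u w * \<bar>c t - t0\<bar>"
    proof (rule norm_diff_le_vector_derivative[OF convex_real_interval(5) _ _ c_in t0_in])
      show "(?D has_vector_derivative F (u s) - F (w s)) (at s within {a..b})" if "s \<in> {a..b}" for s
        by (intro derivative_intros J_der that) auto
      show "norm (F (u s) - F (w s)) \<le> L * dist u w" for s
      proof -
        have "norm (F (u s) - F (w s)) \<le> L * dist (u s) (w s)"
          using lipschitz_onD[OF lip, of "u s" "w s"] by (simp add: dist_norm)
        also have "\<dots> \<le> L * dist u w"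
          by (intro mult_left_mono dist_bounded \<open>L \<ge> 0\<close>)
        finally show ?thesis .
      qed
    qed
    also have "\<dots> \<le> L * dist u w * \<delta>"
      using c_in[of t] \<open>L \<ge> 0\<close> by (intro mult_left_mono) (auto simp: a_def b_def)
    finally show "dist (T u t) (T w t) \<le> L * \<delta> * dist u w"
      unfolding T by (simp add: P_def dist_norm algebra_simps)
  qed
  then have "\<exists>!u. T u = u"
    using \<open>L \<ge> 0\<close> \<open>\<delta> > 0\<close> small by (intro banach_fix_type[of "L * \<delta>"]) auto
  then obtain u where u: "T u = u" by blast
  have eq: "u t = P u t" for t
    using T[of u] u by simp
  show thesis
  proof
    show "u t0 = x0"
      unfolding eq[of t0] P_def by (simp add: c_id[OF t0_in])
    fix t assume t: "t \<in> {t0 - \<delta><..<t0 + \<delta>}"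
    then have t': "t \<in> {a<..<b}" by (simp add: a_def b_def)
    have "(J u has_vector_derivative F (u t)) (at t within {a..b})"
      using t' by (intro J_der) auto
    then have "(J u has_vector_derivative F (u t)) (at t within {a<..<b})"
      by (rule has_vector_derivative_within_subset) auto
    then have "(J u has_vector_derivative F (u t)) (at t)"
      using t' at_within_open[of t "{a<..<b}"] by simp
    then have "((\<lambda>s. x0 + (J u s - J u t0)) has_vector_derivative F (u t)) (at t)"
      by (auto intro!: derivative_eq_intros)
    then show "(u has_vector_derivative F (u t)) (at t)"
    proof (rule has_vector_derivative_transform_within_open[of _ _ _ "{a<..<b}"])
      show "x0 + (J u s - J u t0) = u s" if "s \<in> {a<..<b}" for s
        unfolding eq[of s] P_def using that by (simp add: c_id)
    qed (use t' in auto)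
  qed
qed

text \<open>Gronwall: the squared distance of two solutions grows at most like \<open>exp (2 * L * t)\<close>.\<close>

lemma lipschitz_ode_unique:
  fixes F :: "'a::real_inner \<Rightarrow> 'a"
  assumes lip: "L-lipschitz_on UNIV F" and I: "is_interval I"
    and X: "\<And>t. t \<in> I \<Longrightarrow> (X has_vector_derivative F (X t)) (at t)"
    and Y: "\<And>t. t \<in> I \<Longrightarrow> (Y has_vector_derivative F (Y t)) (at t)"
    and "t0 \<in> I" "X t0 = Y t0" "t \<in> I"
  shows "X t = Y t"
proof -
  define h h' where "h s = (X s - Y s) \<bullet> (X s - Y s)"
    and "h' s = 2 * ((X s - Y s) \<bullet> (F (X s) - F (Y s)))" for s
  have h_der: "(h has_real_derivative h' s) (at s)" if "s \<in> I" for s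
  proof -
    have "((\<lambda>s. X s - Y s) has_derivative (\<lambda>k. k *\<^sub>R (F (X s) - F (Y s)))) (at s)"
      using has_vector_derivative_diff[OF X[OF that] Y[OF that]]
      unfolding has_vector_derivative_def .
    note * = has_derivative_inner[OF this this]
    show ?thesis
      unfolding h_def h'_def has_field_derivative_def
      by (rule has_derivative_eq_rhs[OF *]) (simp add: fun_eq_iff inner_commute)
  qed
  have h'_bound: "\<bar>h' s\<bar> \<le> 2 * L * h s" for s
  proof -
    have "\<bar>h' s\<bar> \<le> 2 * (norm (X s - Y s) * norm (F (X s) - F (Y s)))"
      unfolding h'_def using Cauchy_Schwarz_ineq2 by (simp add: abs_mult)
    also have "\<dots> \<le> 2 * (norm (X s - Y s) * (L * norm (X s - Y s)))"
      using lipschitz_onD[OF lip, of "X s" "Y s"]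
      by (intro mult_left_mono) (auto simp: dist_norm)
    also have "\<dots> = 2 * L * h s"
      by (simp add: h_def dot_square_norm power2_eq_square)
    finally show ?thesis .
  qed
  have "h t0 = 0" by (simp add: h_def \<open>X t0 = Y t0\<close>)
  have "h t \<le> 0"
  proof (cases "t0 \<le> t")
    case True
    have sub: "{t0..t} \<subseteq> I"
      by (rule subsetI, rule mem_is_interval_1_I[OF I \<open>t0 \<in> I\<close> \<open>t \<in> I\<close>]) auto
    have "h t * exp (- (2 * L * t)) \<le> h t0 * exp (- (2 * L * t0))"
    proof (rule DERIV_nonpos_imp_nonincreasing[OF True])
      fix s assume "t0 \<le> s" "s \<le> t"
      then have "((\<lambda>s. h s * exp (- (2 * L * s))) has_real_derivative
          (h' s - 2 * L * h s) * exp (- (2 * L * s))) (at s)"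
        using sub by (auto intro!: derivative_eq_intros h_der simp: algebra_simps)
      moreover have "(h' s - 2 * L * h s) * exp (- (2 * L * s)) \<le> 0"
        using h'_bound[of s] by (intro mult_nonpos_nonneg) auto
      ultimately show "\<exists>y. ((\<lambda>s. h s * exp (- (2 * L * s))) has_real_derivative y) (at s) \<and> y \<le> 0"
        by blast
    qed
    then show ?thesis using \<open>h t0 = 0\<close> by (simp add: mult_le_0_iff)
  next
    case False
    then have "t \<le> t0" by simp
    have sub: "{t..t0} \<subseteq> I"
      by (rule subsetI, rule mem_is_interval_1_I[OF I \<open>t \<in> I\<close> \<open>t0 \<in> I\<close>]) auto
    \<comment> \<open>Backwards in time the lower bound \<open>h' \<ge> - 2 * L * h\<close> is the
      relevant one, hence the opposite sign in the integrating factor.\<close>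
    have "h t * exp (2 * L * t) \<le> h t0 * exp (2 * L * t0)"
    proof (rule DERIV_nonneg_imp_nondecreasing[OF \<open>t \<le> t0\<close>])
      fix s assume "t \<le> s" "s \<le> t0"
      then have "((\<lambda>s. h s * exp (2 * L * s)) has_real_derivative
          (h' s + 2 * L * h s) * exp (2 * L * s)) (at s)"
        using sub by (auto intro!: derivative_eq_intros h_der simp: algebra_simps)
      moreover have "(h' s + 2 * L * h s) * exp (2 * L * s) \<ge> 0"
        using h'_bound[of s] by (intro mult_nonneg_nonneg) auto
      ultimately show "\<exists>y. ((\<lambda>s. h s * exp (2 * L * s)) has_real_derivative y) (at s) \<and> 0 \<le> y"
        by blast
    qed
    then show ?thesis using \<open>h t0 = 0\<close> by (simp add: mult_le_0_iff)
  qed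
  then show ?thesis by (simp add: h_def dot_square_norm)
qed

text \<open>The second-order equation \<open>z'' = f z\<close> as a first-order autonomous system
  for position and velocity.\<close>

definition phase_field :: "(real \<Rightarrow> real) \<Rightarrow> real \<times> real \<Rightarrow> real \<times> real" where
  "phase_field f p = (snd p, f (fst p))"

lemma lipschitz_on_phase_field:
  assumes lip: "L-lipschitz_on UNIV f"
  shows "(1 + L)-lipschitz_on UNIV (phase_field f)"
proof (rule lipschitz_onI)
  have "L \<ge> 0" using lip by (rule lipschitz_on_nonneg)
  then show "0 \<le> 1 + L" by simp
  fix p r :: "real \<times> real"
  have "dist (phase_field f p) (phase_field f r) \<le> dist (snd p) (snd r) + dist (f (fst p)) (f (fst r))"
    unfolding phase_field_def dist_prod_def by (simp add: sqrt_sum_squares_le_sum)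
  also have "\<dots> \<le> dist p r + L * dist p r"
    using lipschitz_onD[OF lip, of "fst p" "fst r"] dist_snd_le[of p r]
      mult_left_mono[OF dist_fst_le[of p r] \<open>L \<ge> 0\<close>] by simp
  finally show "dist (phase_field f p) (phase_field f r) \<le> (1 + L) * dist p r"
    by (simp add: algebra_simps)
qed

lemma phase_field_curve_iff:
  "(X has_vector_derivative phase_field f (X t)) (at t) \<longleftrightarrow>
     ((\<lambda>t. fst (X t)) has_real_derivative snd (X t)) (at t) \<and>
     ((\<lambda>t. snd (X t)) has_real_derivative f (fst (X t))) (at t)" (is "?L \<longleftrightarrow> ?R")
proof
  assume ?L
  then have "(X has_derivative (\<lambda>h. h *\<^sub>R phase_field f (X t))) (at t)"
    by (simp add: has_vector_derivative_def)
  from has_derivative_fst[OF this] has_derivative_snd[OF this] show ?R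
    by (simp add: has_field_derivative_def phase_field_def mult_commute_abs)
next
  assume ?R
  then have "((\<lambda>t. (fst (X t), snd (X t))) has_vector_derivative (snd (X t), f (fst (X t)))) (at t)"
    by (intro has_vector_derivative_Pair) (auto simp: has_real_derivative_iff_has_vector_derivative)
  then show ?L by (simp add: phase_field_def)
qed

section \<open>Motion in an even potential well of finite depth\<close>

lemma lipschitz_on_sum_exists:
  fixes g :: "'i \<Rightarrow> 'a::metric_space \<Rightarrow> 'b::real_normed_vector"
  assumes "\<And>i. i \<in> A \<Longrightarrow> \<exists>L. L-lipschitz_on S (g i)"
  shows "\<exists>L. L-lipschitz_on S (\<lambda>x. \<Sum>i\<in>A. g i x)"
  using assms
proof (induction A rule: infinite_finite_induct)
  case (insert i A)
  then obtain L M where "L-lipschitz_on S (g i)" "M-lipschitz_on S (\<lambda>x. \<Sum>i\<in>A. g i x)"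
    by blast
  then show ?case using insert.hyps by (auto intro: lipschitz_on_add)
qed (auto intro: lipschitz_on_constant)

text \<open>By the mean value theorem on \<open>[t, t + 1]\<close>, \<open>h (t + 1) - h t\<close>
  is a value of \<open>h'\<close> at some point beyond \<open>t\<close>. The left side tends to
  \<open>l - l\<close>, the right side to \<open>c\<close>.\<close>

lemma tendsto_imp_derivative_tendsto_0:
  fixes h h' :: "real \<Rightarrow> real"
  assumes der: "\<And>t. t \<ge> t0 \<Longrightarrow> (h has_real_derivative h' t) (at t)"
    and h: "(h \<longlongrightarrow> l) at_top" and h': "(h' \<longlongrightarrow> c) at_top"
  shows "c = 0"
proof -
  have "\<exists>x. t < x \<and> h (t + 1) - h t = h' x" if "t \<ge> t0" for t
    using MVT2[of t "t + 1" h h'] der that by fastforce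
  then obtain x where x: "\<And>t. t \<ge> t0 \<Longrightarrow> t < x t \<and> h (t + 1) - h t = h' (x t)"
    by metis
  have "filterlim x at_top at_top"
    by (rule filterlim_at_top_mono[OF filterlim_ident])
      (use x in \<open>auto intro!: eventually_at_top_linorderI[of t0] less_imp_le\<close>)
  then have "((\<lambda>t. h' (x t)) \<longlongrightarrow> c) at_top"
    by (rule filterlim_compose[OF h'])
  then have "((\<lambda>t. h (t + 1) - h t) \<longlongrightarrow> c) at_top"
    by (rule Lim_transform_eventually) (use x in \<open>auto intro!: eventually_at_top_linorderI[of t0]\<close>)
  moreover have "filterlim (\<lambda>t::real. t + 1) at_top at_top"
    by (rule filterlim_at_top_mono[OF filterlim_ident]) auto
  then have "((\<lambda>t. h (t + 1) - h t) \<longlongrightarrow> l - l) at_top"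
    by (intro tendsto_diff h filterlim_compose[OF h])
  ultimately show ?thesis
    using tendsto_unique[OF trivial_limit_at_top_linorder] by force
qed

lemma nonvanishing_constant_sign:
  fixes v :: "real \<Rightarrow> real"
  assumes "continuous_on S v" "connected S" "\<And>t. t \<in> S \<Longrightarrow> v t \<noteq> 0"
  shows "(\<forall>t\<in>S. v t > 0) \<or> (\<forall>t\<in>S. v t < 0)"
proof (rule ccontr)
  assume "\<not> ?thesis"
  then obtain s t where "s \<in> S" "t \<in> S" "v s \<le> 0" "v t \<ge> 0"
    by (auto simp: not_less)
  moreover have "connected (v ` S)"
    using assms by (intro connected_continuous_image)
  ultimately have "0 \<in> v ` S"
    using connectedD_interval[of "v ` S" "v s" "v t" 0] by blast
  then show False using assms(3) by force
qed

text \<open>Abstract form of the axial problem. \<open>W\<close> is minus the potential energy, so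
  its derivative is the force itself and the energy is \<open>v\<^sup>2 / 2 - W z\<close>; the
  bottom of the well is the peak of \<open>W\<close> at the origin.\<close>

locale restoring_force =
  fixes f W :: "real \<Rightarrow> real" and L :: real
  assumes lipschitz: "L-lipschitz_on UNIV f"
    and odd: "f (- z) = - f z"
    and W_even: "W (- z) = W z"
    and f_nonzero: "z \<noteq> 0 \<Longrightarrow> f z \<noteq> 0"
    and W_deriv: "(W has_real_derivative f z) (at z)"
    and W_less: "z \<noteq> 0 \<Longrightarrow> W z < W 0"
    and W_pos: "W z > 0"
    and W_tendsto: "(W \<longlongrightarrow> 0) at_top"
begin

text \<open>The velocity is a separate argument so that reflections in space and time can be applied
  to both components directly.\<close>

definition trajectory :: "(real \<Rightarrow> real) \<Rightarrow> (real \<Rightarrow> real) \<Rightarrow> bool" where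
  "trajectory z v \<longleftrightarrow>
     (\<forall>t. (z has_real_derivative v t) (at t) \<and> (v has_real_derivative f (z t)) (at t))"

lemma trajectory_phase:
  "trajectory z v \<longleftrightarrow> (\<forall>t. ((\<lambda>t. (z t, v t)) has_vector_derivative phase_field f (z t, v t)) (at t))"
  using phase_field_curve_iff[of "\<lambda>t. (z t, v t)"] by (simp add: trajectory_def)

lemma trajectory_unique:
  assumes "trajectory z v" "trajectory y w" "z t0 = y t0" "v t0 = w t0"
  shows "z t = y t" "v t = w t"
proof -
  have "(z t, v t) = (y t, w t)"
    by (rule lipschitz_ode_unique[OF lipschitz_on_phase_field[OF lipschitz] is_interval_univ,
          of "\<lambda>t. (z t, v t)" "\<lambda>t. (y t, w t)" t0])
      (use assms in \<open>auto simp: trajectory_phase\<close>)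
  then show "z t = y t" "v t = w t" by auto
qed

section \<open>Symmetries of the flow, conservation of energy, and turning times\<close>

lemma trajectory_uminus: "trajectory z v \<Longrightarrow> trajectory (\<lambda>t. - z t) (\<lambda>t. - v t)"
  by (auto simp: trajectory_def odd intro: DERIV_minus)

text \<open>The force depends on position only, and the two sign changes cancel in the second
  derivative. The map \<open>t \<mapsto> a - t\<close> is the reflection about
  \<open>a / 2\<close>.\<close>

lemma trajectory_reverse: "trajectory z v \<Longrightarrow> trajectory (\<lambda>t. z (a - t)) (\<lambda>t. - v (a - t))"
  using DERIV_chain2[where g = "\<lambda>t. a - t" and Db = "-1"]
  unfolding trajectory_def
  by (fastforce intro!: derivative_eq_intros)

lemma energy_conserved:
  assumes "trajectory z v"
  shows "(v t)\<^sup>2 / 2 - W (z t) = (v s)\<^sup>2 / 2 - W (z s)"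
proof -
  have "((\<lambda>t. (v t)\<^sup>2 / 2 - W (z t)) has_real_derivative 0) (at t)" for t
    using assms unfolding trajectory_def
    by (auto intro!: derivative_eq_intros DERIV_chain2[OF W_deriv])
  then show ?thesis by (intro DERIV_isconst_all) auto
qed

text \<open>The motion reversed about \<open>\<tau>\<close> has at time \<open>\<tau>\<close> the
  same position and velocity \<open>- v \<tau> = 0 = v \<tau>\<close>, so uniqueness identifies it
  with the original.\<close>

lemma reflection:
  assumes "trajectory z v" "v \<tau> = 0"
  shows "z (2 * \<tau> - t) = z t"
  using trajectory_unique(1)[OF trajectory_reverse[OF assms(1), of "2 * \<tau>"] assms(1), of \<tau> t] assms(2)
  by simp

text \<open>The composition of the reflections in two turning times is a translation.\<close>

lemma periodic_if_two_turning_times: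
  assumes "trajectory z v" "v \<tau>1 = 0" "v \<tau>2 = 0" "\<tau>1 \<noteq> \<tau>2"
  shows "periodic z"
proof -
  have *: "z (t + 2 * \<bar>b - a\<bar>) = z t" if "v a = 0" "v b = 0" "a < b" for a b t
    using reflection[OF assms(1) that(1), of t] reflection[OF assms(1) that(2), of "2 * a - t"] that(3)
    by (simp add: algebra_simps)
  consider "\<tau>1 < \<tau>2" | "\<tau>2 < \<tau>1" using assms(4) by linarith
  then show ?thesis
    by cases (use *[OF assms(2,3)] *[OF assms(3,2)] in
      \<open>auto simp: periodic_def intro!: exI[of _ "2 * \<bar>\<tau>2 - \<tau>1\<bar>"] exI[of _ "2 * \<bar>\<tau>1 - \<tau>2\<bar>"]\<close>)
qed

section \<open>Escape to infinity when the velocity eventually has no zero\<close>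

lemma isCont_W: "isCont W z"
  using W_deriv by (rule DERIV_isCont)

lemma isCont_f: "isCont f z"
  using lipschitz_on_continuous_on[OF lipschitz] by (simp add: continuous_on_eq_continuous_at)

lemma energy_ge: "v\<^sup>2 / 2 - W z \<ge> - W 0"
proof -
  have "W z \<le> W 0" using W_less[of z] by (cases "z = 0") auto
  then show ?thesis using zero_le_power2[of v] by linarith
qed

text \<open>If \<open>z\<close> stayed bounded it would converge to a limit at which both the speed and the
  force vanish, that is, to the origin, and the energy would be minimal.\<close>

lemma escape_if_moving_up:
  assumes traj: "trajectory z v" and energy: "\<And>t. (v t)\<^sup>2 / 2 - W (z t) = E"
    and E: "E > - W 0" and up: "\<And>t. t \<ge> t0 \<Longrightarrow> v t > 0"
  shows "filterlim z at_top at_top" "(v \<longlongrightarrow> sqrt (2 * E)) at_top" "E \<ge> 0"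
proof -
  have mono: "z s \<le> z t" if "t0 \<le> s" "s \<le> t" for s t
    by (rule DERIV_nonneg_imp_nondecreasing[OF that(2)])
      (use traj up that in \<open>auto simp: trajectory_def intro!: less_imp_le\<close>)
  have v_eq: "v t = sqrt (2 * (E + W (z t)))" if "t \<ge> t0" for t
  proof -
    have "(v t)\<^sup>2 = 2 * (E + W (z t))" using energy[of t] by (simp add: field_simps)
    then show ?thesis using up[OF that] by (simp add: real_sqrt_unique)
  qed
  \<comment> \<open>Used twice: with \<open>c = W l\<close> to refute a finite limit
    \<open>l\<close> of the position, and with \<open>c = 0\<close> once the particle is known to
    escape.\<close>
  have v_tendsto: "(v \<longlongrightarrow> sqrt (2 * (E + c))) at_top" if "((\<lambda>t. W (z t)) \<longlongrightarrow> c) at_top" for c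
  proof -
    have "((\<lambda>t. sqrt (2 * (E + W (z t)))) \<longlongrightarrow> sqrt (2 * (E + c))) at_top"
      by (intro tendsto_intros that)
    then show ?thesis
      by (rule Lim_transform_eventually) (use v_eq in \<open>auto intro!: eventually_at_top_linorderI[of t0]\<close>)
  qed
  have unbounded: "\<exists>t\<ge>t0. B < z t" for B
  proof (rule ccontr)
    assume "\<not> ?thesis"
    then have "bdd_above (z ` {t0..})" by (auto simp: not_less intro!: bdd_aboveI)
    then have z_le: "z t \<le> (SUP s\<in>{t0..}. z s)" if "t \<ge> t0" for t
      using that by (auto intro: cSUP_upper)
    define l where "l = (SUP s\<in>{t0..}. z s)"
    have z_lim: "(z \<longlongrightarrow> l) at_top"
    proof (rule increasing_tendsto)
      show "\<forall>\<^sub>F t in at_top. z t \<le> l"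
        unfolding l_def using z_le by (rule eventually_at_top_linorderI)
      fix x assume "x < l"
      then obtain s where "s \<ge> t0" "x < z s"
        unfolding l_def using \<open>bdd_above (z ` {t0..})\<close> by (auto simp: less_cSUP_iff)
      then show "\<forall>\<^sub>F t in at_top. x < z t"
        using mono[of s] by (intro eventually_at_top_linorderI[of s]) force
    qed
    have v_lim: "(v \<longlongrightarrow> sqrt (2 * (E + W l))) at_top"
      by (rule v_tendsto) (rule isCont_tendsto_compose[OF isCont_W z_lim])
    have "sqrt (2 * (E + W l)) = 0"
      by (rule tendsto_imp_derivative_tendsto_0[OF _ z_lim v_lim]) (use traj in \<open>auto simp: trajectory_def\<close>)
    moreover have "f l = 0"
      by (rule tendsto_imp_derivative_tendsto_0[OF _ v_lim isCont_tendsto_compose[OF isCont_f z_lim]])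
        (use traj in \<open>auto simp: trajectory_def\<close>)
    then have "l = 0" using f_nonzero by blast
    ultimately show False using E by simp
  qed
  show z_lim: "filterlim z at_top at_top"
    unfolding filterlim_at_top
  proof
    fix B
    obtain s where "s \<ge> t0" "B < z s" using unbounded by blast
    then show "\<forall>\<^sub>F t in at_top. B \<le> z t"
      using mono[of s] by (intro eventually_at_top_linorderI[of s]) force
  qed
  have W_lim: "((\<lambda>t. W (z t)) \<longlongrightarrow> 0) at_top"
    by (rule filterlim_compose[OF W_tendsto z_lim])
  from v_tendsto[OF this] show "(v \<longlongrightarrow> sqrt (2 * E)) at_top" by simp
  \<comment> \<open>\<open>E + W (z t)\<close> is the kinetic energy; as \<open>W (z t)\<close>
    tends to \<open>0\<close>, \<open>E\<close> is a limit of nonnegative numbers.\<close>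
  have "E + W (z t) \<ge> 0" for t
    using energy[of t] zero_le_power2[of "v t"] by linarith
  moreover have "((\<lambda>t. E + W (z t)) \<longlongrightarrow> E + 0) at_top"
    by (intro tendsto_intros W_lim)
  ultimately show "E \<ge> 0"
    using tendsto_lowerbound[of "\<lambda>t. E + W (z t)" "E + 0" at_top 0] by simp
qed

text \<open>After \<open>t0\<close> the velocity keeps one sign, and downward motion becomes upward
  under \<open>z \<mapsto> - z\<close>, which preserves the energy because \<open>W\<close> is even.
  The conclusion \<open>E \<ge> 0\<close> serves by contraposition: negative energy above the
  minimum forces turning times.\<close>

lemma escape_if_no_turning:
  assumes traj: "trajectory z v" and energy: "\<And>t. (v t)\<^sup>2 / 2 - W (z t) = E"
    and E: "E > - W 0" and nz: "\<And>t. t \<ge> t0 \<Longrightarrow> v t \<noteq> 0"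
  shows "filterlim (\<lambda>t. \<bar>z t\<bar>) at_top at_top"
    "(v \<longlongrightarrow> sqrt (2 * E)) at_top \<or> (v \<longlongrightarrow> - sqrt (2 * E)) at_top" "E \<ge> 0"
proof -
  have "continuous_on {t0..} v"
    using traj by (auto simp: trajectory_def intro!: continuous_at_imp_continuous_on DERIV_isCont)
  then have "(\<forall>t\<in>{t0..}. v t > 0) \<or> (\<forall>t\<in>{t0..}. v t < 0)"
    by (rule nonvanishing_constant_sign) (use nz in auto)
  then have "filterlim (\<lambda>t. \<bar>z t\<bar>) at_top at_top \<and> E \<ge> 0 \<and>
    ((v \<longlongrightarrow> sqrt (2 * E)) at_top \<or> (v \<longlongrightarrow> - sqrt (2 * E)) at_top)"
  proof
    assume "\<forall>t\<in>{t0..}. v t > 0"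
    then show ?thesis
      using escape_if_moving_up[OF traj energy E, of t0]
      by (auto intro: filterlim_at_top_mono[of z, OF _ always_eventually])
  next
    assume "\<forall>t\<in>{t0..}. v t < 0"
    then have "filterlim (\<lambda>t. - z t) at_top at_top" "((\<lambda>t. - v t) \<longlongrightarrow> sqrt (2 * E)) at_top" "E \<ge> 0"
      using escape_if_moving_up[OF trajectory_uminus[OF traj] _ E, of t0] energy
      by (auto simp: W_even)
    then show ?thesis
      using tendsto_minus_cancel_left[of v "sqrt (2 * E)"] by (auto intro: filterlim_at_top_mono[of "\<lambda>t. - z t", OF _ always_eventually])
  qed
  then show "filterlim (\<lambda>t. \<bar>z t\<bar>) at_top at_top"
    "(v \<longlongrightarrow> sqrt (2 * E)) at_top \<or> (v \<longlongrightarrow> - sqrt (2 * E)) at_top" "E \<ge> 0" by auto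
qed

lemma trajectory_trichotomy:
  assumes traj: "trajectory z v" and energy: "\<And>t. (v t)\<^sup>2 / 2 - W (z t) = E"
  shows "E > 0 \<Longrightarrow> filterlim (\<lambda>t. \<bar>z t\<bar>) at_top at_top \<and> (\<exists>c. (v \<longlongrightarrow> c) at_top \<and> c \<noteq> 0)"
    and "E = 0 \<Longrightarrow> filterlim (\<lambda>t. \<bar>z t\<bar>) at_top at_top \<and> (v \<longlongrightarrow> 0) at_top"
    and "- W 0 < E \<Longrightarrow> E < 0 \<Longrightarrow> periodic z"
    and "E = - W 0 \<Longrightarrow> equilibrium z"
proof -
  \<comment> \<open>A zero of the velocity would give \<open>E = - W (z t) < 0\<close>.\<close>
  have v_nz: "v t \<noteq> 0" if "E \<ge> 0" for t
    using energy[of t] W_pos[of "z t"] that by auto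
  have E_gt: "- W 0 < E" if "E \<ge> 0"
    using W_pos[of 0] that by linarith
  note escape = escape_if_no_turning[OF traj energy E_gt v_nz, of 0]
  show "filterlim (\<lambda>t. \<bar>z t\<bar>) at_top at_top \<and> (\<exists>c. (v \<longlongrightarrow> c) at_top \<and> c \<noteq> 0)" if "E > 0"
    using escape(1,2) that by force
  show "filterlim (\<lambda>t. \<bar>z t\<bar>) at_top at_top \<and> (v \<longlongrightarrow> 0) at_top" if "E = 0"
    using escape(1,2) that by simp
  show "periodic z" if "- W 0 < E" "E < 0"
  proof -
    have turning: "\<exists>t\<ge>t0. v t = 0" for t0
      using escape_if_no_turning(3)[OF traj energy \<open>- W 0 < E\<close>, of t0] \<open>E < 0\<close> by force
    obtain \<tau>1 where "v \<tau>1 = 0" using turning by blast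
    \<comment> \<open>Searching from \<open>\<tau>1 + 1\<close> onwards guarantees that the two
      turning times differ.\<close>
    moreover obtain \<tau>2 where "\<tau>2 \<ge> \<tau>1 + 1" "v \<tau>2 = 0" using turning by blast
    ultimately show ?thesis by (intro periodic_if_two_turning_times[OF traj, of \<tau>1 \<tau>2]) auto
  qed
  show "equilibrium z" if "E = - W 0"
  proof -
    \<comment> \<open>Away from the origin \<open>- W (z t)\<close> already exceeds
      \<open>- W 0\<close>, which would leave a negative kinetic energy.\<close>
    have "z t = 0" for t
    proof (rule ccontr)
      assume "z t \<noteq> 0"
      from W_less[OF this] show False
        using energy[of t] zero_le_power2[of "v t"] that by linarith
    qed
    then show ?thesis by (auto simp: equilibrium_def)
  qed
qed

end

section \<open>The axial problem\<close>

lemma solves_onI: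
  assumes "open S" "is_interval S" "S \<noteq> {}"
    and z: "\<And>t. t \<in> S \<Longrightarrow> (z has_real_derivative v t) (at t)"
    and v: "\<And>t. t \<in> S \<Longrightarrow> (v has_real_derivative axial_accel n m q (z t)) (at t)"
  shows "solves_on n m q S z"
  unfolding solves_on_def
proof (intro conjI ballI assms)
  fix t assume t: "t \<in> S"
  have eq: "deriv z s = v s" if "s \<in> S" for s
    using z[OF that] by (rule DERIV_imp_deriv)
  show "(z has_real_derivative deriv z t) (at t)"
    using z[OF t] eq[OF t] by simp
  show "(deriv z has_real_derivative axial_accel n m q (z t)) (at t)"
    by (rule has_field_derivative_transform_within_open[OF v[OF t] \<open>open S\<close> t]) (simp add: eq)
qed

text \<open>A local solution with the data of \<open>z\<close> at \<open>t0\<close> agrees with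
  \<open>z\<close> on the overlap by uniqueness, so the two can be glued. The overlap is an interval
  containing \<open>t0\<close>, as uniqueness requires.\<close>

lemma solves_on_extend:
  assumes lip: "L-lipschitz_on UNIV (axial_accel n m q)"
    and sol: "solves_on n m q S z" and "t0 \<in> S" and "\<delta> > 0" and small: "(1 + L) * \<delta> < 1"
  obtains w where "solves_on n m q (S \<union> {t0 - \<delta><..<t0 + \<delta>}) w" "\<And>t. t \<in> S \<Longrightarrow> w t = z t"
proof -
  let ?F = "phase_field (axial_accel n m q)"
  let ?J = "{t0 - \<delta><..<t0 + \<delta>}"
  note lipF = lipschitz_on_phase_field[OF lip]
  have S: "open S" "is_interval S" and
    z: "\<And>t. t \<in> S \<Longrightarrow> (z has_real_derivative deriv z t) (at t)" and
    z': "\<And>t. t \<in> S \<Longrightarrow> (deriv z has_real_derivative axial_accel n m q (z t)) (at t)"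
    using sol by (auto simp: solves_on_def)
  have t0: "t0 \<in> S \<inter> ?J" using \<open>t0 \<in> S\<close> \<open>\<delta> > 0\<close> by simp
  obtain X where X0: "X t0 = (z t0, deriv z t0)"
    and X: "\<And>t. t \<in> ?J \<Longrightarrow> (X has_vector_derivative ?F (X t)) (at t)"
    using lipschitz_ode_local_existence[OF lipF \<open>\<delta> > 0\<close> small] by blast
  have X_der: "((\<lambda>t. fst (X t)) has_real_derivative snd (X t)) (at t)"
    "((\<lambda>t. snd (X t)) has_real_derivative axial_accel n m q (fst (X t))) (at t)" if "t \<in> ?J" for t
    using X[OF that] unfolding phase_field_curve_iff by auto
  have agree: "X t = (z t, deriv z t)" if "t \<in> S \<inter> ?J" for t
  proof (rule lipschitz_ode_unique[OF lipF, where Y = "\<lambda>t. (z t, deriv z t)"])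
    show "is_interval (S \<inter> ?J)"
      by (intro is_interval_Int S is_interval_oo)
    show "((\<lambda>t. (z t, deriv z t)) has_vector_derivative ?F (z t, deriv z t)) (at t)"
      if "t \<in> S \<inter> ?J" for t
      using phase_field_curve_iff[of "\<lambda>t. (z t, deriv z t)"] z z' that by simp
  qed (use X t0 X0 that in auto)
  define w v where "w t = (if t \<in> S then z t else fst (X t))"
    and "v t = (if t \<in> S then deriv z t else snd (X t))" for t
  \<comment> \<open>Thus \<open>w\<close> is \<open>z\<close> on the open set \<open>S\<close> and
    the first component of \<open>X\<close> on the open interval, and each point can be
    differentiated in whichever piece contains it.\<close>
  have w_J: "w t = fst (X t)" "v t = snd (X t)" if "t \<in> ?J" for t
    using agree that by (auto simp: w_def v_def)
  show thesis
  proof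
    show "solves_on n m q (S \<union> ?J) w"
    proof (rule solves_onI)
      show "open (S \<union> ?J)" "S \<union> ?J \<noteq> {}" using S t0 by auto
      have "connected (S \<union> ?J)"
        using S t0 by (intro connected_Un) (auto simp: is_interval_connected_1)
      then show "is_interval (S \<union> ?J)" by (simp add: is_interval_connected_1)
      fix t assume "t \<in> S \<union> ?J"
      then consider "t \<in> S" | "t \<in> ?J" by blast
      then show "(w has_real_derivative v t) (at t)"
      proof cases
        case 1
        show ?thesis
          by (rule has_field_derivative_transform_within_open[OF _ \<open>open S\<close> 1])
            (use z[OF 1] 1 in \<open>auto simp: w_def v_def\<close>)
      next
        case 2
        show ?thesis
          by (rule has_field_derivative_transform_within_open[OF _ open_greaterThanLessThan 2])
            (use X_der[OF 2] 2 w_J in auto)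
      qed
      from \<open>t \<in> S \<union> ?J\<close> consider "t \<in> S" | "t \<in> ?J" by blast
      then show "(v has_real_derivative axial_accel n m q (w t)) (at t)"
      proof cases
        case 1
        show ?thesis
          by (rule has_field_derivative_transform_within_open[OF _ \<open>open S\<close> 1])
            (use z'[OF 1] 1 in \<open>auto simp: w_def v_def\<close>)
      next
        case 2
        show ?thesis
          by (rule has_field_derivative_transform_within_open[OF _ open_greaterThanLessThan 2])
            (use X_der[OF 2] 2 w_J in auto)
      qed
    qed
  qed (simp add: w_def)
qed

text \<open>By maximality the domain contains a \<open>\<delta>\<close>-neighbourhood of each of its
  points, with one \<open>\<delta>\<close> for all. Hence it is closed as well as open, and it is
  nonempty.\<close>

lemma maximal_solution_UNIV:
  assumes lip: "L-lipschitz_on UNIV (axial_accel n m q)"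
    and max: "maximal_solution n m q S z"
  shows "S = UNIV"
proof -
  have sol: "solves_on n m q S z" using max by (simp add: maximal_solution_def)
  have "L \<ge> 0" using lip by (rule lipschitz_on_nonneg)
  \<comment> \<open>The phase field has Lipschitz constant \<open>1 + L\<close>, so this choice
    keeps the contraction factor below \<open>1\<close>.\<close>
  define \<delta> where "\<delta> = 1 / (2 + L)"
  have \<delta>: "\<delta> > 0" "(1 + L) * \<delta> < 1"
    using \<open>L \<ge> 0\<close> by (auto simp: \<delta>_def field_simps)
  have sub: "{t0 - \<delta><..<t0 + \<delta>} \<subseteq> S" if t0: "t0 \<in> S" for t0
  proof -
    obtain w where "solves_on n m q (S \<union> {t0 - \<delta><..<t0 + \<delta>}) w" "\<And>t. t \<in> S \<Longrightarrow> w t = z t"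
      using solves_on_extend[OF lip sol t0 \<delta>] by blast
    then have "S \<union> {t0 - \<delta><..<t0 + \<delta>} = S"
      using max unfolding maximal_solution_def by blast
    then show ?thesis by blast
  qed
  have "closure S \<subseteq> S"
  proof
    fix t assume "t \<in> closure S"
    then obtain t0 where "t0 \<in> S" "dist t0 t < \<delta>"
      using \<delta>(1) closure_approachable by blast
    then have "t \<in> {t0 - \<delta><..<t0 + \<delta>}" by (auto simp: dist_real_def abs_less_iff)
    then show "t \<in> S" using sub[OF \<open>t0 \<in> S\<close>] by blast
  qed
  then have "closed S" by (simp add: closure_subset_eq)
  moreover have "open S" "S \<noteq> {}" using sol by (auto simp: solves_on_def)
  ultimately show ?thesis using clopen[of S] by blast
qed

section \<open>The force of the primaries on the axis and its potential, one primary at a time and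
  then summed\<close>

definition axial_potential :: "nat \<Rightarrow> masses \<Rightarrow> positions \<Rightarrow> real \<Rightarrow> real" where
  "axial_potential n m q z = (\<Sum>i=1..n. m i / ((norm (q i))\<^sup>2 + z\<^sup>2) powr (1/2))"

text \<open>The derivative is bounded because \<open>s > 0\<close> keeps the denominator away from
  zero; this is where collisionlessness enters.\<close>

lemma kernel_lipschitz:
  fixes s \<mu> :: real
  assumes "s > 0"
  shows "\<exists>L. L-lipschitz_on UNIV (\<lambda>z. \<mu> * z / (s\<^sup>2 + z\<^sup>2) powr (3/2))"
proof
  \<comment> \<open>The quotient-rule derivative, written so that the ratio
    \<open>z\<^sup>2 / (s\<^sup>2 + z\<^sup>2)\<close> in \<open>[0, 1]\<close> stands alone; the
    last factor then lies in \<open>[-2, 1]\<close>.\<close>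
  define D where "D z = \<mu> / (s\<^sup>2 + z\<^sup>2) powr (3/2) * (1 - 3 * (z\<^sup>2 / (s\<^sup>2 + z\<^sup>2)))" for z
  have pos: "s\<^sup>2 + z\<^sup>2 > 0" for z
    using assms by (intro add_pos_nonneg) auto
  have der: "((\<lambda>z. \<mu> * z / (s\<^sup>2 + z\<^sup>2) powr (3/2)) has_real_derivative D z) (at z)" for z
  proof -
    have p: "(s\<^sup>2 + z\<^sup>2) powr (1/2) = (s\<^sup>2 + z\<^sup>2) powr (3/2) / (s\<^sup>2 + z\<^sup>2)"
      using powr_diff[of "s\<^sup>2 + z\<^sup>2" "3/2" 1] pos[of z] by simp
    have "((\<lambda>z. (s\<^sup>2 + z\<^sup>2) powr (3/2)) has_real_derivative
        3/2 * (s\<^sup>2 + z\<^sup>2) powr (1/2) * (2 * z)) (at z)"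
      using pos[of z] by (auto intro!: derivative_eq_intros simp: powr_diff p)
    note quotient = DERIV_divide[OF DERIV_cmult_Id[of \<mu>] this]
    \<comment> \<open>With \<open>P\<close> for the \<open>3/2\<close> power and \<open>N\<close>
      for its base, \<open>p\<close> turns the exponent \<open>1/2\<close> into
      \<open>P / N\<close>, and only a rational identity remains.\<close>
    have alg: "(\<mu> * P - \<mu> * z * (3/2 * (P / N) * (2 * z))) / (P * P) = \<mu> / P * (1 - 3 * (z\<^sup>2 / N))"
      if "P \<noteq> 0" "N \<noteq> 0" for P N :: real
      using that by (simp add: field_simps power2_eq_square)
    have nz: "(s\<^sup>2 + z\<^sup>2) powr (3/2) \<noteq> 0" "s\<^sup>2 + z\<^sup>2 \<noteq> 0"
      using pos[of z] by auto
    show ?thesis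
      unfolding D_def by (rule DERIV_cong[OF quotient[OF nz(1)]]) (unfold p, rule alg[OF nz])
  qed
  have bound: "norm (D z) \<le> \<bar>\<mu>\<bar> / (s\<^sup>2) powr (3/2) * 2" for z
  proof -
    have "0 \<le> z\<^sup>2 / (s\<^sup>2 + z\<^sup>2)" "z\<^sup>2 / (s\<^sup>2 + z\<^sup>2) \<le> 1"
      using pos[of z] by (auto simp: field_simps)
    then have "\<bar>1 - 3 * (z\<^sup>2 / (s\<^sup>2 + z\<^sup>2))\<bar> \<le> 2" by linarith
    moreover have "\<bar>\<mu>\<bar> / (s\<^sup>2 + z\<^sup>2) powr (3/2) \<le> \<bar>\<mu>\<bar> / (s\<^sup>2) powr (3/2)"
      using assms by (intro divide_left_mono powr_mono2 mult_pos_pos) (auto simp: pos)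
    ultimately show ?thesis
      unfolding D_def real_norm_def abs_mult abs_divide
      by (intro mult_mono) auto
  qed
  show "(\<bar>\<mu>\<bar> / (s\<^sup>2) powr (3/2) * 2)-lipschitz_on UNIV (\<lambda>z. \<mu> * z / (s\<^sup>2 + z\<^sup>2) powr (3/2))"
    using field_differentiable_bound[OF convex_UNIV der bound]
    by (intro lipschitz_onI) (auto simp: dist_norm)
qed

lemma kernel_deriv:
  fixes s \<mu> :: real
  assumes "s > 0"
  shows "((\<lambda>z. \<mu> / (s\<^sup>2 + z\<^sup>2) powr (1/2)) has_real_derivative - (\<mu> * z / (s\<^sup>2 + z\<^sup>2) powr (3/2))) (at z)"
proof -
  have pos: "s\<^sup>2 + z\<^sup>2 > 0"
    using assms by (intro add_pos_nonneg) auto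
  have "((\<lambda>z. \<mu> * (s\<^sup>2 + z\<^sup>2) powr (-1/2)) has_real_derivative
      \<mu> * (-1/2 * (s\<^sup>2 + z\<^sup>2) powr (-1/2 - 1) * (2 * z))) (at z)"
    using pos by (auto intro!: derivative_eq_intros simp: powr_diff)
  moreover have "\<mu> * (s\<^sup>2 + z\<^sup>2) powr (-1/2) = \<mu> / (s\<^sup>2 + z\<^sup>2) powr (1/2)" for z
    using powr_minus_divide[of "s\<^sup>2 + z\<^sup>2" "1/2"] by simp
  moreover have "\<mu> * (-1/2 * (s\<^sup>2 + z\<^sup>2) powr (-1/2 - 1) * (2 * z)) = - (\<mu> * z / (s\<^sup>2 + z\<^sup>2) powr (3/2))"
    using powr_minus_divide[of "s\<^sup>2 + z\<^sup>2" "3/2"] by simp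
  ultimately show ?thesis by simp
qed

lemma kernel_tendsto: "((\<lambda>z::real. \<mu> / (s\<^sup>2 + z\<^sup>2) powr (1/2)) \<longlongrightarrow> 0) at_top"
proof (rule real_tendsto_divide_at_top[OF tendsto_const])
  have "z \<le> (s\<^sup>2 + z\<^sup>2) powr (1/2)" for z :: real
    by (simp add: powr_half_sqrt real_le_rsqrt)
  then show "filterlim (\<lambda>z::real. (s\<^sup>2 + z\<^sup>2) powr (1/2)) at_top at_top"
    by (intro filterlim_at_top_mono[OF filterlim_ident always_eventually]) auto
qed

text \<open>Every property holds for a single primary and passes to the sum;
  \<open>n \<ge> 1\<close> makes the sum nonempty, so that strict inequalities survive.\<close>

lemma axial_restoring_force:
  assumes "n \<ge> 1" and m: "\<And>i. i \<in> {1..n} \<Longrightarrow> m i > 0" and q: "\<And>i. i \<in> {1..n} \<Longrightarrow> q i \<noteq> 0"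
  obtains L where "restoring_force (axial_accel n m q) (axial_potential n m q) L"
proof -
  have s: "norm (q i) > 0" if "i \<in> {1..n}" for i using q[OF that] by simp
  have pos: "(norm (q i))\<^sup>2 + z\<^sup>2 > 0" if "i \<in> {1..n}" for i z
    using s[OF that] by (intro add_pos_nonneg) auto
  have powr_pos: "((norm (q i))\<^sup>2 + z\<^sup>2) powr e > 0" if "i \<in> {1..n}" for i z e
    unfolding powr_gt_zero using pos[OF that, of z] by linarith
  have ne: "{1..n} \<noteq> {}" using \<open>n \<ge> 1\<close> by simp
  have "\<exists>L. L-lipschitz_on UNIV (\<lambda>z. \<Sum>i=1..n. m i * z / ((norm (q i))\<^sup>2 + z\<^sup>2) powr (3/2))"
    by (intro lipschitz_on_sum_exists kernel_lipschitz s)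
  then obtain L where L: "L-lipschitz_on UNIV (axial_accel n m q)"
    unfolding axial_accel_def using lipschitz_on_minus by blast
  show thesis
  proof (rule that, unfold_locales)
    show "L-lipschitz_on UNIV (axial_accel n m q)" by (rule L)
    fix z :: real
    show "axial_accel n m q (- z) = - axial_accel n m q z"
      by (simp add: axial_accel_def sum_negf)
    show "axial_potential n m q (- z) = axial_potential n m q z"
      by (simp add: axial_potential_def)
    show "axial_accel n m q z \<noteq> 0" if "z \<noteq> 0"
    proof -
      have "(\<Sum>i=1..n. m i * z / ((norm (q i))\<^sup>2 + z\<^sup>2) powr (3/2)) =
          z * (\<Sum>i=1..n. m i / ((norm (q i))\<^sup>2 + z\<^sup>2) powr (3/2))"
        by (simp add: sum_distrib_left mult_ac)
      moreover have "(\<Sum>i=1..n. m i / ((norm (q i))\<^sup>2 + z\<^sup>2) powr (3/2)) > 0"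
        by (intro sum_pos ne divide_pos_pos) (use m powr_pos in auto)
      ultimately show ?thesis using that by (simp add: axial_accel_def)
    qed
    show "(axial_potential n m q has_real_derivative axial_accel n m q z) (at z)"
      unfolding axial_potential_def axial_accel_def sum_negf[symmetric]
      by (intro DERIV_sum kernel_deriv s)
    show "axial_potential n m q z < axial_potential n m q 0" if "z \<noteq> 0"
      unfolding axial_potential_def
    proof (intro sum_strict_mono ne)
      fix i assume i: "i \<in> {1..n}"
      have "((norm (q i))\<^sup>2 + 0\<^sup>2) powr (1/2) < ((norm (q i))\<^sup>2 + z\<^sup>2) powr (1/2)"
        using that s[OF i] by (intro powr_less_mono2) auto
      then show "m i / ((norm (q i))\<^sup>2 + z\<^sup>2) powr (1/2) < m i / ((norm (q i))\<^sup>2 + 0\<^sup>2) powr (1/2)"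
        using m[OF i] s[OF i] by (intro divide_strict_left_mono mult_pos_pos) (auto simp: powr_pos[OF i])
    qed simp
    show "axial_potential n m q z > 0"
      unfolding axial_potential_def
      by (intro sum_pos ne divide_pos_pos) (use m powr_pos in auto)
    show "(axial_potential n m q \<longlongrightarrow> 0) at_top"
      unfolding axial_potential_def by (intro tendsto_null_sum kernel_tendsto)
  qed
qed

section \<open>Classification of the axial motions by the energy\<close>

theorem theorem4:
  fixes n :: nat and m :: "nat \<Rightarrow> real" and q :: "nat \<Rightarrow> real ^ 3"
    and I :: "real set" and z :: "real \<Rightarrow> real"
  assumes "n \<ge> 2"
    and "planar_configuration n m q"
    and "central_configuration n m q"
    and "balanced n m q"
    and "collisionless n q"
    and "maximal_solution n m q I z"
  shows "I = UNIV \<and>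
    (\<exists>E. (\<forall>t. axial_energy n m q (z t) (deriv z t) = E) \<and>
      ((E > 0 \<and> hyperbolic z) \<or>
       (E = 0 \<and> parabolic z) \<or>
       (energy_min n m q < E \<and> E < 0 \<and> periodic z) \<or>
       (E = energy_min n m q \<and> equilibrium z)))"
proof -
  let ?W = "axial_potential n m q"
  obtain L where "restoring_force (axial_accel n m q) ?W L"
    using assms by (auto simp: planar_configuration_def collisionless_def
        intro: axial_restoring_force[of n m q])
  then interpret restoring_force "axial_accel n m q" ?W L .
  have I: "I = UNIV"
    using lipschitz assms(6) by (rule maximal_solution_UNIV)
  have traj: "trajectory z (deriv z)"
    using assms(6) by (auto simp: I maximal_solution_def solves_on_def trajectory_def)
  define E where "E = axial_energy n m q (z 0) (deriv z 0)"
  have energy_eq: "axial_energy n m q x v = v\<^sup>2 / 2 - ?W x" for x v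
    by (simp add: axial_energy_def axial_potential_def)
  have energy: "(deriv z t)\<^sup>2 / 2 - ?W (z t) = E" for t
    unfolding E_def energy_eq by (rule energy_conserved[OF traj])
  have E_min: "energy_min n m q = - ?W 0"
    by (simp add: energy_min_def axial_potential_def powr_half_sqrt)
  \<comment> \<open>The energy never lies below the bottom of the well, so the four cases are
    exhaustive.\<close>
  have "E \<ge> - ?W 0"
    using energy_ge[of "deriv z 0" "z 0"] energy[of 0] by simp
  then consider "E > 0" | "E = 0" | "- ?W 0 < E" "E < 0" | "E = - ?W 0"
    by linarith
  then have "(E > 0 \<and> hyperbolic z) \<or> (E = 0 \<and> parabolic z) \<or>
       (energy_min n m q < E \<and> E < 0 \<and> periodic z) \<or> (E = energy_min n m q \<and> equilibrium z)"
    unfolding E_min hyperbolic_def parabolic_def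
    using trajectory_trichotomy[OF traj energy] by cases auto
  then show ?thesis
    using I energy energy_eq by auto
qed

end
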